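(* Let $(X,\sigma)$ be a left non-degenerate braided set. Let $(M,\cdot)$ be a right module and $(N,\cdot)$ a left module over $(X,\sigma)$. (1) A pre-cubical structure on the sets $C_k=M\times X^{\times k}\times N$, $k\geqslant0$, is given by the maps ($1\leqslant i\leqslant k$) $$d_i\colon(m,y_1,\dots,y_k,n)\mapsto(m,\;y_i\,\tilde{\cdot}\,y_1,\dots,y_i\,\tilde{\cdot}\,y_{i-1},\;y_i\cdot y_{i+1},\dots,y_i\cdot y_k,\;y_i\cdot n),$$ $$d'_i\colon(m,y_1,\dots,y_k,n)\mapsto(m\cdot\chi_i(y_1,\dots,y_k),\;y_1,\dots,y_{i-1},y_{i+1},\dots,y_k,\;n).$$ (2) The extended guitar map $\mathrm{Id}_M\times J\times\mathrm{Id}_N$ yields an isomorphism between the pre-cubical structure $(d^{r,-}_i,d^{l,+}_i)$ and the structure $(d_i,d'_i)$; that is, denoting it again by $J$, it is a bijection on each $C_k$ with $J\circ d^{r,-}_i=d_i\circ J$ and $J\circ d^{l,+}_i=d'_i\circ J$.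
   Context: A braided set is a set $X$ with a (not necessarily invertible) map $\sigma\colon X\times X\to X\times X$, $\sigma(a,b)=({}^{a}b,a^b)$, satisfying the Yang--Baxter equation $(\sigma\times\mathrm{Id})(\mathrm{Id}\times\sigma)(\sigma\times\mathrm{Id})=(\mathrm{Id}\times\sigma)(\sigma\times\mathrm{Id})(\mathrm{Id}\times\sigma)$. It is left non-degenerate if for every $b\in X$ the map $a\mapsto a^b$ is bijective; then $a\mapsto b\,\tilde{\cdot}\,a$ denotes its inverse, and for $a,b\in X$ one puts $a\cdot b={}^{(b\,\tilde{\cdot}\,a)}b$. The associated shelf operation is $a\triangleleft_\sigma b=(b\cdot a)^b$. A right module over $(X,\sigma)$ is a set $M$ with a map $\rho\colon M\times X\to M$, $(m,a)\mapsto m\cdot a$, such that $(m\cdot a)\cdot b=(m\cdot{}^{a}b)\cdot a^b$. A left module is a set $N$ with a map $\lambda\colon X\times N\to N$, $(a,n)\mapsto a\cdot n$, such that $a\cdot(b\cdot n)={}^{a}b\cdot(a^b\cdot n)$. A pre-cubical structure on sets $C_k$, $k\geqslant0$, consists of two families of maps $d^+_i,d^-_i\colon C_k\to C_{k-1}$ ($k\geqslant1$, $1\leqslant i\leqslant k$) with $d^\varepsilon_id^\zeta_j=d^\zeta_{j-1}d^\varepsilon_i$ for all $i<j$ and $\varepsilon,\zeta\in\{+,-\}$. The $k$-guitar map $J\colon X^{\times k}\to X^{\times k}$ is $J(x_1,\dots,x_k)=(J_1,\dots,J_k)$ with $J_i=(\cdots(x_i^{x_{i+1}})\cdots)^{x_k}$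 (so $J_k=x_k$). It is bijective for left non-degenerate $(X,\sigma)$; write $J^{-1}=(J^{-1}_1,\dots,J^{-1}_k)$ for the components of its inverse. The maps $\chi_i\colon X^{\times k}\to X$ are $$\chi_i(y_1,\dots,y_k)=J_1^{-1}\bigl((\cdots(y_i\triangleleft_\sigma y_{i-1})\cdots)\triangleleft_\sigma y_1,\;y_1,\dots,y_{i-1},y_{i+1},\dots,y_k\bigr).$$ On $C_k=M\times X^{\times k}\times N$, let $\sigma_j$ be $\sigma$ applied to the $j$th and $(j+1)$st $X$-components, $\rho_0$ be $\rho$ applied to the $M$-component and first $X$-component, and $\lambda_k$ be $\lambda$ applied to the last $X$-component and the $N$-component. Then $d^{l,+}_i=\rho_0\circ\sigma_1\circ\cdots\circ\sigma_{i-1}$ and $d^{r,-}_i=\lambda_k\circ\sigma_{k-1}\circ\cdots\circ\sigma_i$ (maps $C_k\to C_{k-1}$); they are known to form a pre-cubical structure. *)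

theory Defs
  imports Main "HOL-Library.FuncSet"
begin

text \<open>
  A braiding \<open>\<sigma>\<close> on \<open>X\<close> is written \<open>\<sigma> (a, b) = (lexp \<sigma> a b, rexp \<sigma> a b)\<close>:
  \<open>lexp \<sigma> a b\<close> is \<open>b\<close> with left superscript \<open>a\<close>, and
  \<open>rexp \<sigma> a b\<close> is \<open>a\<close> with right superscript \<open>b\<close>.
\<close>

definition lexp :: "('x \<times> 'x \<Rightarrow> 'x \<times> 'x) \<Rightarrow> 'x \<Rightarrow> 'x \<Rightarrow> 'x" where
  "lexp \<sigma> a b = fst (\<sigma> (a, b))"

definition rexp :: "('x \<times> 'x \<Rightarrow> 'x \<times> 'x) \<Rightarrow> 'x \<Rightarrow> 'x \<Rightarrow> 'x" where
  "rexp \<sigma> a b = snd (\<sigma> (a, b))"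

definition braid_Id :: "('x \<times> 'x \<Rightarrow> 'x \<times> 'x) \<Rightarrow> 'x \<times> 'x \<times> 'x \<Rightarrow> 'x \<times> 'x \<times> 'x" where
  "braid_Id \<sigma> = (\<lambda>(a, b, c). (lexp \<sigma> a b, rexp \<sigma> a b, c))"

definition Id_braid :: "('x \<times> 'x \<Rightarrow> 'x \<times> 'x) \<Rightarrow> 'x \<times> 'x \<times> 'x \<Rightarrow> 'x \<times> 'x \<times> 'x" where
  "Id_braid \<sigma> = (\<lambda>(a, b, c). (a, lexp \<sigma> b c, rexp \<sigma> b c))"

definition braided_set :: "'x set \<Rightarrow> ('x \<times> 'x \<Rightarrow> 'x \<times> 'x) \<Rightarrow> bool" where
  "braided_set X \<sigma> \<longleftrightarrow>
     \<sigma> \<in> (X \<times> X) \<rightarrow> (X \<times> X) \<and>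
     (\<forall>t \<in> X \<times> X \<times> X.
        (braid_Id \<sigma> \<circ> Id_braid \<sigma> \<circ> braid_Id \<sigma>) t = (Id_braid \<sigma> \<circ> braid_Id \<sigma> \<circ> Id_braid \<sigma>) t)"

definition left_nondegenerate :: "'x set \<Rightarrow> ('x \<times> 'x \<Rightarrow> 'x \<times> 'x) \<Rightarrow> bool" where
  "left_nondegenerate X \<sigma> \<longleftrightarrow> (\<forall>b \<in> X. bij_betw (\<lambda>a. rexp \<sigma> a b) X X)"

text \<open>
  \<open>tdot X \<sigma> b a\<close> is \<open>b\<close> tilde-dot \<open>a\<close> and \<open>sdot X \<sigma> a b\<close> is \<open>a\<close> dot \<open>b\<close>.
  These operations, and \<open>shelf\<close>, are meaningful only on \<open>X\<close> and for left non-degenerate \<open>\<sigma>\<close>.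
\<close>

definition tdot :: "'x set \<Rightarrow> ('x \<times> 'x \<Rightarrow> 'x \<times> 'x) \<Rightarrow> 'x \<Rightarrow> 'x \<Rightarrow> 'x" where
  "tdot X \<sigma> b = inv_into X (\<lambda>a. rexp \<sigma> a b)"

definition sdot :: "'x set \<Rightarrow> ('x \<times> 'x \<Rightarrow> 'x \<times> 'x) \<Rightarrow> 'x \<Rightarrow> 'x \<Rightarrow> 'x" where
  "sdot X \<sigma> a b = lexp \<sigma> (tdot X \<sigma> b a) b"

definition shelf :: "'x set \<Rightarrow> ('x \<times> 'x \<Rightarrow> 'x \<times> 'x) \<Rightarrow> 'x \<Rightarrow> 'x \<Rightarrow> 'x" where
  "shelf X \<sigma> a b = rexp \<sigma> (sdot X \<sigma> b a) b"

definition right_module ::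
  "'x set \<Rightarrow> ('x \<times> 'x \<Rightarrow> 'x \<times> 'x) \<Rightarrow> 'm set \<Rightarrow> ('m \<Rightarrow> 'x \<Rightarrow> 'm) \<Rightarrow> bool" where
  "right_module X \<sigma> M \<rho> \<longleftrightarrow>
     \<rho> \<in> M \<rightarrow> X \<rightarrow> M \<and>
     (\<forall>m \<in> M. \<forall>a \<in> X. \<forall>b \<in> X. \<rho> (\<rho> m a) b = \<rho> (\<rho> m (lexp \<sigma> a b)) (rexp \<sigma> a b))"

definition left_module ::
  "'x set \<Rightarrow> ('x \<times> 'x \<Rightarrow> 'x \<times> 'x) \<Rightarrow> 'n set \<Rightarrow> ('x \<Rightarrow> 'n \<Rightarrow> 'n) \<Rightarrow> bool" where
  "left_module X \<sigma> N \<mu> \<longleftrightarrow>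
     \<mu> \<in> X \<rightarrow> N \<rightarrow> N \<and>
     (\<forall>a \<in> X. \<forall>b \<in> X. \<forall>n \<in> N. \<mu> a (\<mu> b n) = \<mu> (lexp \<sigma> a b) (\<mu> (rexp \<sigma> a b) n))"

text \<open>
  \<open>d k i\<close> is the face map \<open>d\<^sub>i\<close> from \<open>C k\<close> to \<open>C (k - 1)\<close>; only \<open>1 \<le> i \<le> k\<close> is relevant.
\<close>

definition pre_cubical ::
  "(nat \<Rightarrow> 'c set) \<Rightarrow> (nat \<Rightarrow> nat \<Rightarrow> 'c \<Rightarrow> 'c) \<Rightarrow> (nat \<Rightarrow> nat \<Rightarrow> 'c \<Rightarrow> 'c) \<Rightarrow> bool" where
  "pre_cubical C dplus dminus \<longleftrightarrow>
     (\<forall>d \<in> {dplus, dminus}. \<forall>k i. 1 \<le> i \<and> i \<le> k \<longrightarrow> d k i \<in> C k \<rightarrow> C (k - 1)) \<and>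
     (\<forall>d \<in> {dplus, dminus}. \<forall>e \<in> {dplus, dminus}. \<forall>k i j. 1 \<le> i \<and> i < j \<and> j \<le> k \<longrightarrow>
        (\<forall>c \<in> C k. d (k - 1) i (e k j c) = e (k - 1) (j - 1) (d k i c)))"

definition pre_cubical_iso ::
  "(nat \<Rightarrow> 'c set) \<Rightarrow> (nat \<Rightarrow> nat \<Rightarrow> 'c \<Rightarrow> 'c) \<Rightarrow> (nat \<Rightarrow> nat \<Rightarrow> 'c \<Rightarrow> 'c) \<Rightarrow>
   (nat \<Rightarrow> 'e set) \<Rightarrow> (nat \<Rightarrow> nat \<Rightarrow> 'e \<Rightarrow> 'e) \<Rightarrow> (nat \<Rightarrow> nat \<Rightarrow> 'e \<Rightarrow> 'e) \<Rightarrow>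
   ('c \<Rightarrow> 'e) \<Rightarrow> bool" where
  "pre_cubical_iso C dplus dminus E eplus eminus f \<longleftrightarrow>
     (\<forall>k. bij_betw f (C k) (E k)) \<and>
     (\<forall>k i. 1 \<le> i \<and> i \<le> k \<longrightarrow>
        (\<forall>c \<in> C k. f (dplus k i c) = eplus k i (f c) \<and> f (dminus k i c) = eminus k i (f c)))"

text \<open>
  A tuple \<open>(x\<^sub>1, \<dots>, x\<^sub>k)\<close> is a list of length \<open>k\<close>. Indices are 1-based as in the usual
  notation, so \<open>x\<^sub>i\<close> is \<open>xs ! (i - 1)\<close>.
\<close>

definition tuples :: "'x set \<Rightarrow> nat \<Rightarrow> 'x list set" where
  "tuples X k = {xs. length xs = k \<and> set xs \<subseteq> X}"

definition chain_set ::
  "'m set \<Rightarrow> 'x set \<Rightarrow> 'n set \<Rightarrow> nat \<Rightarrow> ('m \<times> 'x list \<times> 'n) set" where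
  "chain_set M X N k = M \<times> tuples X k \<times> N"

definition guitar_comp :: "('x \<times> 'x \<Rightarrow> 'x \<times> 'x) \<Rightarrow> nat \<Rightarrow> 'x list \<Rightarrow> 'x" where
  "guitar_comp \<sigma> i xs = foldl (rexp \<sigma>) (xs ! (i - 1)) (drop i xs)"

definition guitar :: "('x \<times> 'x \<Rightarrow> 'x \<times> 'x) \<Rightarrow> 'x list \<Rightarrow> 'x list" where
  "guitar \<sigma> xs = map (\<lambda>i. guitar_comp \<sigma> i xs) [1..<length xs + 1]"

definition ext_guitar ::
  "('x \<times> 'x \<Rightarrow> 'x \<times> 'x) \<Rightarrow> 'm \<times> 'x list \<times> 'n \<Rightarrow> 'm \<times> 'x list \<times> 'n" where
  "ext_guitar \<sigma> = map_prod id (map_prod (guitar \<sigma>) id)"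

definition guitar_inv :: "'x set \<Rightarrow> ('x \<times> 'x \<Rightarrow> 'x \<times> 'x) \<Rightarrow> nat \<Rightarrow> 'x list \<Rightarrow> 'x list" where
  "guitar_inv X \<sigma> k = inv_into (tuples X k) (guitar \<sigma>)"

definition chi ::
  "'x set \<Rightarrow> ('x \<times> 'x \<Rightarrow> 'x \<times> 'x) \<Rightarrow> nat \<Rightarrow> nat \<Rightarrow> 'x list \<Rightarrow> 'x" where
  "chi X \<sigma> k i ys =
     hd (guitar_inv X \<sigma> k
       (foldl (shelf X \<sigma>) (ys ! (i - 1)) (rev (take (i - 1) ys)) # take (i - 1) ys @ drop i ys))"

definition braid_at ::
  "('x \<times> 'x \<Rightarrow> 'x \<times> 'x) \<Rightarrow> nat \<Rightarrow> 'm \<times> 'x list \<times> 'n \<Rightarrow> 'm \<times> 'x list \<times> 'n" where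
  "braid_at \<sigma> j = (\<lambda>(m, xs, n).
     (m, xs[j - 1 := lexp \<sigma> (xs ! (j - 1)) (xs ! j), j := rexp \<sigma> (xs ! (j - 1)) (xs ! j)], n))"

definition act_right ::
  "('m \<Rightarrow> 'x \<Rightarrow> 'm) \<Rightarrow> 'm \<times> 'x list \<times> 'n \<Rightarrow> 'm \<times> 'x list \<times> 'n" where
  "act_right \<rho> = (\<lambda>(m, xs, n). (\<rho> m (hd xs), tl xs, n))"

definition act_left ::
  "('x \<Rightarrow> 'n \<Rightarrow> 'n) \<Rightarrow> 'm \<times> 'x list \<times> 'n \<Rightarrow> 'm \<times> 'x list \<times> 'n" where
  "act_left \<mu> = (\<lambda>(m, xs, n). (m, butlast xs, \<mu> (last xs) n))"

text \<open>
  The composite of the \<open>\<sigma>\<^sub>j\<close> in \<open>d_left_plus\<close> applies \<open>\<sigma>\<^bsub>i-1\<^esub>\<close> first (hence \<open>foldr\<close>), the one in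
  \<open>d_right_minus\<close> applies \<open>\<sigma>\<^sub>i\<close> first (hence \<open>fold\<close>).
\<close>

definition d_left_plus ::
  "('x \<times> 'x \<Rightarrow> 'x \<times> 'x) \<Rightarrow> ('m \<Rightarrow> 'x \<Rightarrow> 'm) \<Rightarrow>
   nat \<Rightarrow> nat \<Rightarrow> 'm \<times> 'x list \<times> 'n \<Rightarrow> 'm \<times> 'x list \<times> 'n" where
  "d_left_plus \<sigma> \<rho> k i = act_right \<rho> \<circ> foldr (braid_at \<sigma>) [1..<i]"

definition d_right_minus ::
  "('x \<times> 'x \<Rightarrow> 'x \<times> 'x) \<Rightarrow> ('x \<Rightarrow> 'n \<Rightarrow> 'n) \<Rightarrow>
   nat \<Rightarrow> nat \<Rightarrow> 'm \<times> 'x list \<times> 'n \<Rightarrow> 'm \<times> 'x list \<times> 'n" where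
  "d_right_minus \<sigma> \<mu> k i = act_left \<mu> \<circ> fold (braid_at \<sigma>) [i..<k]"

definition face ::
  "'x set \<Rightarrow> ('x \<times> 'x \<Rightarrow> 'x \<times> 'x) \<Rightarrow> ('x \<Rightarrow> 'n \<Rightarrow> 'n) \<Rightarrow>
   nat \<Rightarrow> nat \<Rightarrow> 'm \<times> 'x list \<times> 'n \<Rightarrow> 'm \<times> 'x list \<times> 'n" where
  "face X \<sigma> \<mu> k i = (\<lambda>(m, ys, n).
     (m,
      map (tdot X \<sigma> (ys ! (i - 1))) (take (i - 1) ys) @ map (sdot X \<sigma> (ys ! (i - 1))) (drop i ys),
      \<mu> (ys ! (i - 1)) n))"

definition face' ::
  "'x set \<Rightarrow> ('x \<times> 'x \<Rightarrow> 'x \<times> 'x) \<Rightarrow> ('m \<Rightarrow> 'x \<Rightarrow> 'm) \<Rightarrow>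
   nat \<Rightarrow> nat \<Rightarrow> 'm \<times> 'x list \<times> 'n \<Rightarrow> 'm \<times> 'x list \<times> 'n" where
  "face' X \<sigma> \<rho> k i = (\<lambda>(m, ys, n).
     (\<rho> m (chi X \<sigma> k i ys), take (i - 1) ys @ drop i ys, n))"

end

theory Submission
  imports Defs
begin

text \<open>
  Pulling \<open>x\<^sub>i\<close> through the entries to its left (right) by \<open>\<sigma>\<close> turns the remaining entries into
  \<open>pull_left\<close> (\<open>pull_right\<close>) and \<open>x\<^sub>i\<close> itself into \<open>foldr L\<close> (\<open>foldl R\<close>), where \<open>L\<close> and \<open>R\<close> are
  the components of \<open>\<sigma>\<close>. By the Yang-Baxter equation, crossings slide through such pulls. This
  gives the cubical identities for \<open>d\<^sup>l\<close> and \<open>d\<^sup>r\<close>. It also expresses the operations on the guitar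
  components: the defining relation \<open>R (foldl R w (pull_right x vs)) (foldl R x vs) =
  foldl R (R w x) vs\<close> identifies the tilde-dot operation, and hence \<open>sdot\<close> and \<open>shelf\<close>, on values
  of \<open>foldl R\<close>. The structure \<open>(d\<^sub>i, d'\<^sub>i)\<close> is then transported along the bijection \<open>J\<close>.
\<close>

section \<open>Transport of pre-cubical structures along isomorphisms\<close>

lemma pre_cubical_transport:
  assumes pc: "pre_cubical C dplus dminus"
    and iso: "pre_cubical_iso C dplus dminus E eplus eminus f"
  shows "pre_cubical E eplus eminus"
proof -
  have bij: "bij_betw f (C k) (E k)" for k
    using iso[unfolded pre_cubical_iso_def, THEN conjunct1] by (rule spec)
  \<comment> \<open>\<open>rel\<close> pairs each family with its counterpart, so one argument
    covers all four sign combinations. It is a relation because the two families may coincide on one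
    side only.\<close>
  define rel where "rel d e \<longleftrightarrow> (d, e) \<in> {(dplus, eplus), (dminus, eminus)}" for d e
  have comm: "f (d k i c) = e k i (f c)"
    if "rel d e" "1 \<le> i" "i \<le> k" "c \<in> C k" for d e k i c
  proof -
    have "f (dplus k i c) = eplus k i (f c) \<and> f (dminus k i c) = eminus k i (f c)"
      using iso[unfolded pre_cubical_iso_def, THEN conjunct2] that(2-) by simp
    then show ?thesis
      using that(1) unfolding rel_def by (elim insertE) simp_all
  qed
  have rel_mem: "d \<in> {dplus, dminus}" if "rel d e" for d e
    using that unfolding rel_def by blast
  have closed: "d k i c \<in> C (k - 1)"
    if "rel d e" "1 \<le> i" "i \<le> k" "c \<in> C k" for d e k i c
    using pc[unfolded pre_cubical_def, THEN conjunct1, THEN bspec, OF rel_mem[OF that(1)]] that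
    by (simp add: Pi_iff)
  have cub: "d (k - 1) i (d' k j c) = d' (k - 1) (j - 1) (d k i c)"
    if "rel d e" "rel d' e'" "1 \<le> i" "i < j" "j \<le> k" "c \<in> C k" for d e d' e' k i j c
    using pc[unfolded pre_cubical_def, THEN conjunct2, THEN bspec, OF rel_mem[OF that(1)],
        THEN bspec, OF rel_mem[OF that(2)], THEN spec, THEN spec, THEN spec, THEN mp, THEN bspec,
        OF conjI[OF that(3) conjI[OF that(4,5)]] that(6)] .
  have rel_ex: "\<exists>d. rel d e" if "e \<in> {eplus, eminus}" for e
    using that unfolding rel_def by blast
  have closed_E: "e k i y \<in> E (k - 1)"
    if e: "e \<in> {eplus, eminus}" and ik: "1 \<le> i" "i \<le> k" and y: "y \<in> E k" for e k i y
  proof -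
    obtain d where d: "rel d e" using rel_ex[OF e] by blast
    obtain c where c: "c \<in> C k" "y = f c"
      using bij[of k] y unfolding bij_betw_def by blast
    show ?thesis
      using comm[OF d ik c(1)] bij_betw_apply[OF bij closed[OF d ik c(1)]] c(2)
      by simp
  qed
  have cub_E: "e (k - 1) i (e' k j y) = e' (k - 1) (j - 1) (e k i y)"
    if e: "e \<in> {eplus, eminus}" "e' \<in> {eplus, eminus}"
      and ij: "1 \<le> i" "i < j" "j \<le> k" and y: "y \<in> E k"
    for e e' k i j y
  proof -
    obtain d d' where d: "rel d e" "rel d' e'" using rel_ex[OF e(1)] rel_ex[OF e(2)] by blast
    obtain c where c: "c \<in> C k" "y = f c"
      using bij[of k] y unfolding bij_betw_def by blast
    have idx: "1 \<le> j" "i \<le> k" "i \<le> k - 1" "1 \<le> j - 1" "j - 1 \<le> k - 1"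
      using ij by auto
    have "e (k - 1) i (e' k j y) = e (k - 1) i (f (d' k j c))"
      by (simp only: c(2) comm[OF d(2) idx(1) ij(3) c(1)])
    also have "\<dots> = f (d (k - 1) i (d' k j c))"
      by (rule comm[OF d(1) ij(1) idx(3) closed[OF d(2) idx(1) ij(3) c(1)], symmetric])
    also have "\<dots> = f (d' (k - 1) (j - 1) (d k i c))"
      by (simp only: cub[OF d ij c(1)])
    also have "\<dots> = e' (k - 1) (j - 1) (f (d k i c))"
      by (rule comm[OF d(2) idx(4,5) closed[OF d(1) ij(1) idx(2) c(1)]])
    also have "\<dots> = e' (k - 1) (j - 1) (e k i y)"
      by (simp only: c(2) comm[OF d(1) ij(1) idx(2) c(1)])
    finally show ?thesis .
  qed
  show ?thesis
    unfolding pre_cubical_def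
  proof (intro conjI ballI allI impI)
    fix e and k i :: nat
    assume "e \<in> {eplus, eminus}" "1 \<le> i \<and> i \<le> k"
    then show "e k i \<in> E k \<rightarrow> E (k - 1)"
      by (intro Pi_I closed_E) simp_all
  next
    fix e e' and k i j :: nat and y
    assume *: "e \<in> {eplus, eminus}" "e' \<in> {eplus, eminus}"
      and "1 \<le> i \<and> i < j \<and> j \<le> k" "y \<in> E k"
    then show "e (k - 1) i (e' k j y) = e' (k - 1) (j - 1) (e k i y)"
      by (intro cub_E[OF *]) simp_all
  qed
qed

section \<open>Recursive form of the guitar map\<close>

lemma guitar_Nil: "guitar \<sigma> [] = []"
  by (simp add: guitar_def)

text \<open>A guitar component depends only on its own entry and those to its right, so prepending
  an entry leaves all old components unchanged. This is the recursion behind the list inductions on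
  the guitar map.\<close>

lemma guitar_Cons: "guitar \<sigma> (x # xs) = foldl (rexp \<sigma>) x xs # guitar \<sigma> xs"
proof -
  have "[1..<length (x # xs) + 1] = 1 # map Suc [1..<length xs + 1]"
    unfolding map_Suc_upt by (simp add: upt_conv_Cons del: upt_Suc)
  \<comment> \<open>Index 0 is excluded: truncated subtraction makes \<open>xs ! (i - 1)\<close> the
    first entry both for \<open>i = 0\<close> and for \<open>i = 1\<close>, so the shift fails
    there.\<close>
  moreover have "guitar_comp \<sigma> (Suc i) (x # xs) = guitar_comp \<sigma> i xs" if "1 \<le> i" for i
    using that by (cases i) (auto simp: guitar_comp_def)
  moreover have "guitar_comp \<sigma> 1 (x # xs) = foldl (rexp \<sigma>) x xs"
    by (simp add: guitar_comp_def)
  ultimately show ?thesis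
    by (simp add: guitar_def del: upt_Suc)
qed

lemma length_guitar [simp]: "length (guitar \<sigma> xs) = length xs"
  by (simp add: guitar_def del: upt_Suc)

lemma tuples_iff: "xs \<in> tuples X k \<longleftrightarrow> length xs = k \<and> set xs \<subseteq> X"
  by (simp add: tuples_def)

section \<open>Pulling one entry through a word\<close>

fun pull_right :: "('x \<times> 'x \<Rightarrow> 'x \<times> 'x) \<Rightarrow> 'x \<Rightarrow> 'x list \<Rightarrow> 'x list" where
  "pull_right \<sigma> x [] = []"
| "pull_right \<sigma> x (v # vs) = lexp \<sigma> x v # pull_right \<sigma> (rexp \<sigma> x v) vs"

text \<open>The rightmost entry is crossed first, so by the time \<open>x\<close> meets
  \<open>u\<close> it has already become \<open>foldr (lexp \<sigma>) us x\<close>.\<close>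

fun pull_left :: "('x \<times> 'x \<Rightarrow> 'x \<times> 'x) \<Rightarrow> 'x list \<Rightarrow> 'x \<Rightarrow> 'x list" where
  "pull_left \<sigma> [] x = []"
| "pull_left \<sigma> (u # us) x = rexp \<sigma> u (foldr (lexp \<sigma>) us x) # pull_left \<sigma> us x"

lemma length_pull_right [simp]: "length (pull_right \<sigma> x vs) = length vs"
  by (induction vs arbitrary: x) auto

lemma length_pull_left [simp]: "length (pull_left \<sigma> us x) = length us"
  by (induction us) auto

lemma pull_right_append:
  "pull_right \<sigma> x (us @ vs) = pull_right \<sigma> x us @ pull_right \<sigma> (foldl (rexp \<sigma>) x us) vs"
  by (induction us arbitrary: x) auto

lemma pull_left_append:
  "pull_left \<sigma> (us @ vs) x = pull_left \<sigma> us (foldr (lexp \<sigma>) vs x) @ pull_left \<sigma> vs x"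
  by (induction us) auto

lemma braid_at_append:
  "braid_at \<sigma> (Suc (length us)) (m, us @ u # x # vs, n) =
     (m, us @ lexp \<sigma> u x # rexp \<sigma> u x # vs, n)"
  by (simp add: braid_at_def list_update_append nth_append)

text \<open>The largest index acts first, which crosses \<open>x\<close> with the last entry of
  \<open>us\<close>. That entry then joins \<open>vs\<close>; hence the induction from the right
  with \<open>x\<close> and \<open>vs\<close> generalized.\<close>

lemma foldr_braid_at:
  "foldr (braid_at \<sigma>) [1..<Suc (length us)] (m, us @ x # vs, n) =
     (m, foldr (lexp \<sigma>) us x # pull_left \<sigma> us x @ vs, n)"
proof (induction us arbitrary: x vs rule: rev_induct)
  case (snoc u us)
  have "[1..<Suc (length (us @ [u]))] = [1..<Suc (length us)] @ [Suc (length us)]"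
    by simp
  then show ?case
    using snoc[of "lexp \<sigma> u x" "rexp \<sigma> u x # vs"]
    by (simp add: braid_at_append pull_left_append del: upt_Suc)
qed simp

lemma fold_braid_at:
  "fold (braid_at \<sigma>) [Suc (length us)..<Suc (length us + length vs)] (m, us @ x # vs, n) =
     (m, us @ pull_right \<sigma> x vs @ [foldl (rexp \<sigma>) x vs], n)"
proof (induction vs arbitrary: us x)
  case (Cons v vs)
  have "[Suc (length us)..<Suc (length us + length (v # vs))] =
      Suc (length us) # [Suc (length (us @ [v]))..<Suc (length (us @ [v]) + length vs)]"
    by (simp add: upt_conv_Cons del: upt_Suc)
  then show ?case
    using Cons[of "us @ [lexp \<sigma> x v]" "rexp \<sigma> x v"]
    by (simp add: braid_at_append del: upt_Suc)
qed simp

lemma d_left_plus_append: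
  assumes "i = Suc (length us)"
  shows "d_left_plus \<sigma> \<rho> k i (m, us @ x # vs, n) =
    (\<rho> m (foldr (lexp \<sigma>) us x), pull_left \<sigma> us x @ vs, n)"
  using foldr_braid_at[of \<sigma> us m x vs n] assms
  by (simp add: d_left_plus_def act_right_def del: upt_Suc)

lemma d_right_minus_append:
  assumes "i = Suc (length us)" "k = Suc (length us + length vs)"
  shows "d_right_minus \<sigma> \<mu> k i (m, us @ x # vs, n) =
    (m, us @ pull_right \<sigma> x vs, \<mu> (foldl (rexp \<sigma>) x vs) n)"
  using assms
  by (simp add: d_right_minus_def fold_braid_at act_left_def butlast_append del: upt_Suc)

lemma split_at:
  assumes "1 \<le> i" "i \<le> length xs"
  obtains us x vs where "xs = us @ x # vs" "i = Suc (length us)"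
proof -
  have "xs = take (i - 1) xs @ xs ! (i - 1) # drop i xs"
    using assms id_take_nth_drop[of "i - 1" xs] by simp
  then show thesis
    using assms by (intro that[of "take (i - 1) xs" "xs ! (i - 1)" "drop i xs"]) auto
qed

section \<open>Consequences of the Yang-Baxter equation for pulls\<close>

locale left_nondegenerate_braided_set =
  fixes X :: "'x set" and \<sigma> :: "'x \<times> 'x \<Rightarrow> 'x \<times> 'x"
  assumes braided: "braided_set X \<sigma>"
    and left_nondeg: "left_nondegenerate X \<sigma>"
begin

abbreviation "L \<equiv> lexp \<sigma>"
abbreviation "R \<equiv> rexp \<sigma>"
abbreviation "P \<equiv> pull_right \<sigma>"
abbreviation "Q \<equiv> pull_left \<sigma>"
abbreviation "J \<equiv> guitar \<sigma>"

lemma lexp_closed [simp]: "a \<in> X \<Longrightarrow> b \<in> X \<Longrightarrow> L a b \<in> X"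
  and rexp_closed [simp]: "a \<in> X \<Longrightarrow> b \<in> X \<Longrightarrow> R a b \<in> X"
  using braided unfolding braided_set_def lexp_def rexp_def Pi_iff by (auto simp: mem_Times_iff)

lemma yang_baxter:
  assumes "a \<in> X" "b \<in> X" "c \<in> X"
  shows "L (L a b) (L (R a b) c) = L a (L b c)"
    and "R (L a b) (L (R a b) c) = L (R a (L b c)) (R b c)"
    and "R (R a (L b c)) (R b c) = R (R a b) c"
proof -
  have "(a, b, c) \<in> X \<times> X \<times> X" using assms by simp
  then have "(braid_Id \<sigma> \<circ> Id_braid \<sigma> \<circ> braid_Id \<sigma>) (a, b, c) =
      (Id_braid \<sigma> \<circ> braid_Id \<sigma> \<circ> Id_braid \<sigma>) (a, b, c)"
    using braided unfolding braided_set_def by blast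
  then show "L (L a b) (L (R a b) c) = L a (L b c)"
    and "R (L a b) (L (R a b) c) = L (R a (L b c)) (R b c)"
    and "R (R a (L b c)) (R b c) = R (R a b) c"
    by (simp_all add: braid_Id_def Id_braid_def)
qed

lemma foldl_rexp_closed [simp]: "x \<in> X \<Longrightarrow> set vs \<subseteq> X \<Longrightarrow> foldl R x vs \<in> X"
  by (induction vs arbitrary: x) auto

lemma foldr_lexp_closed [simp]: "x \<in> X \<Longrightarrow> set us \<subseteq> X \<Longrightarrow> foldr L us x \<in> X"
  by (induction us) auto

lemma pull_right_closed: "x \<in> X \<Longrightarrow> set vs \<subseteq> X \<Longrightarrow> set (P x vs) \<subseteq> X"
  by (induction vs arbitrary: x) auto

lemma pull_left_closed: "x \<in> X \<Longrightarrow> set us \<subseteq> X \<Longrightarrow> set (Q us x) \<subseteq> X"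
  by (induction us) auto

text \<open>Iterated Yang-Baxter equation for the word \<open>us @ [x, z]\<close>: \<open>x\<close>
  and then \<open>z\<close> are pulled left through \<open>us\<close>, and their mutual crossing may
  take place after or before these pulls. The three parts compare the two strands and the word
  passed through.\<close>

lemma pull_left_braid:
  assumes "x \<in> X" "z \<in> X" "set us \<subseteq> X"
  shows "L (foldr L us x) (foldr L (Q us x) z) = foldr L us (L x z)"
    and "R (foldr L us x) (foldr L (Q us x) z) = foldr L (Q us (L x z)) (R x z)"
    and "Q (Q us x) z = Q (Q us (L x z)) (R x z)"
  using assms
proof (induction us)
  case (Cons u us)
  { case 1 then show ?case
      using Cons.IH(1) yang_baxter(1)[of u "foldr L us x" "foldr L (Q us x) z"]
      by (simp add: pull_left_closed) next
    case 2 then show ?case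
      using Cons.IH(1,2) yang_baxter(2)[of u "foldr L us x" "foldr L (Q us x) z"]
      by (simp add: pull_left_closed) next
    case 3 then show ?case
      using Cons.IH yang_baxter(3)[of u "foldr L us x" "foldr L (Q us x) z"]
      by (simp add: pull_left_closed) }
qed simp_all

text \<open>Mirror image for the word \<open>x # y # vs\<close>: now \<open>y\<close> passes through
  \<open>vs\<close> first, followed by \<open>x\<close>.\<close>

lemma pull_right_braid:
  assumes "x \<in> X" "y \<in> X" "set vs \<subseteq> X"
  shows "L (foldl R x (P y vs)) (foldl R y vs) = foldl R (L x y) (P (R x y) vs)"
    and "R (foldl R x (P y vs)) (foldl R y vs) = foldl R (R x y) vs"
    and "P x (P y vs) = P (L x y) (P (R x y) vs)"
  using assms
proof (induction vs arbitrary: x y)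
  case (Cons v vs)
  { case 1 then show ?case
      using Cons.IH(1)[of "R x (L y v)" "R y v"] by (simp add: yang_baxter) next
    case 2 then show ?case
      using Cons.IH(2)[of "R x (L y v)" "R y v"] by (simp add: yang_baxter) next
    case 3 then show ?case
      using Cons.IH(3)[of "R x (L y v)" "R y v"] by (simp add: yang_baxter) }
qed simp_all

text \<open>In the word \<open>x # vs @ [y]\<close> the strand \<open>x\<close> travels right and
  \<open>y\<close> travels left. Either one may pass through \<open>vs\<close> first, so that they
  meet at the right or at the left end of \<open>vs\<close>; Yang-Baxter at each entry of
  \<open>vs\<close> identifies the outcomes.\<close>

lemma pull_cross:
  assumes "x \<in> X" "y \<in> X" "set vs \<subseteq> X"
  shows "foldr L (P x vs) (L (foldl R x vs) y) = L x (foldr L vs y)"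
    and "Q (P x vs) (L (foldl R x vs) y) = P (R x (foldr L vs y)) (Q vs y)"
    and "foldl R (R x (foldr L vs y)) (Q vs y) = R (foldl R x vs) y"
  using assms
proof (induction vs arbitrary: x)
  case (Cons v vs)
  { case 1 then show ?case
      using Cons.IH(1)[of "R x v"] by (simp add: yang_baxter) next
    case 2 then show ?case
      using Cons.IH(1,2)[of "R x v"] by (simp add: yang_baxter) next
    case 3 then show ?case
      using Cons.IH(3)[of "R x v"] by (simp add: yang_baxter) }
qed simp_all

section \<open>The derived operations on guitar components\<close>

lemma tdot_rexp: "a \<in> X \<Longrightarrow> b \<in> X \<Longrightarrow> tdot X \<sigma> b (R a b) = a"
  using left_nondeg unfolding left_nondegenerate_def tdot_def bij_betw_def
  by (metis (no_types, lifting) inv_into_f_f)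

text \<open>In the word \<open>w # x # vs\<close> the arguments are the guitar components of
  \<open>x\<close> and \<open>w\<close>. Part (2) of \<open>pull_right_braid\<close> exhibits the
  right-hand side as the preimage that \<open>tdot\<close> selects.\<close>

lemma tdot_foldl:
  assumes "w \<in> X" "x \<in> X" "set vs \<subseteq> X"
  shows "tdot X \<sigma> (foldl R x vs) (foldl R (R w x) vs) = foldl R w (P x vs)"
  using assms pull_right_closed tdot_rexp[of "foldl R w (P x vs)" "foldl R x vs"]
  by (simp add: pull_right_braid(2))

lemma sdot_foldl:
  assumes "x \<in> X" "y \<in> X" "set vs \<subseteq> X"
  shows "sdot X \<sigma> (foldl R (R x y) vs) (foldl R y vs) = foldl R (L x y) (P (R x y) vs)"
  using assms by (simp add: sdot_def tdot_foldl pull_right_braid(1))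

text \<open>One shelf operation performs one crossing: for the first two components of
  \<open>x # y # vs\<close> it yields the first component of
  \<open>L x y # R x y # vs\<close>.\<close>

lemma shelf_foldl:
  assumes "x \<in> X" "y \<in> X" "set vs \<subseteq> X"
  shows "shelf X \<sigma> (foldl R y vs) (foldl R (R x y) vs) = foldl R (R (L x y) (R x y)) vs"
  using assms pull_right_braid(2)[of "L x y" "R x y" vs] by (simp add: shelf_def sdot_foldl)

section \<open>Bijectivity of the guitar map\<close>

lemma bij_foldl_rexp: "set vs \<subseteq> X \<Longrightarrow> bij_betw (\<lambda>x. foldl R x vs) X X"
proof (induction vs)
  case (Cons v vs)
  have "bij_betw (\<lambda>a. R a v) X X"
    using left_nondeg Cons.prems unfolding left_nondegenerate_def by simp
  then have "bij_betw ((\<lambda>x. foldl R x vs) \<circ> (\<lambda>a. R a v)) X X"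
    using Cons by (intro bij_betw_trans) auto
  then show ?case by (simp add: comp_def)
qed (simp add: bij_betw_def)

lemma guitar_closed: "set xs \<subseteq> X \<Longrightarrow> set (J xs) \<subseteq> X"
  by (induction xs) (auto simp: guitar_Nil guitar_Cons)

text \<open>The map is triangular: the tail of the image determines the tail of the word, and for
  that fixed tail the first component is a bijective function of the first entry.\<close>

lemma guitar_inj: "set xs \<subseteq> X \<Longrightarrow> set ys \<subseteq> X \<Longrightarrow> J xs = J ys \<Longrightarrow> xs = ys"
proof (induction xs arbitrary: ys)
  case Nil
  then show ?case by (cases ys) (auto simp: guitar_Nil guitar_Cons)
next
  case (Cons x xs)
  then obtain y ys' where ys: "ys = y # ys'"
    by (cases ys) (auto simp: guitar_Nil guitar_Cons)
  with Cons have "xs = ys'" by (auto simp: guitar_Cons)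
  moreover from this have "x = y"
    using Cons.prems ys bij_foldl_rexp[of xs]
    by (auto simp: guitar_Cons bij_betw_def dest: inj_onD)
  ultimately show ?case using ys by simp
qed

lemma guitar_surj: "set ys \<subseteq> X \<Longrightarrow> \<exists>xs. set xs \<subseteq> X \<and> J xs = ys"
proof (induction ys)
  case Nil
  then show ?case by (intro exI[of _ "[]"]) (simp add: guitar_Nil)
next
  case (Cons y ys)
  then obtain xs where xs: "set xs \<subseteq> X" "J xs = ys" by auto
  moreover obtain x where "x \<in> X" "foldl R x xs = y"
    using bij_foldl_rexp[OF xs(1)] Cons.prems unfolding bij_betw_def
    by (metis (no_types, lifting) imageE list.set_intros(1) subset_iff)
  ultimately show ?case
    by (intro exI[of _ "x # xs"]) (simp add: guitar_Cons)
qed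

lemma bij_guitar: "bij_betw J (tuples X k) (tuples X k)"
proof (rule bij_betw_imageI)
  show "inj_on J (tuples X k)"
    using guitar_inj by (auto simp: inj_on_def tuples_iff)
  show "J ` tuples X k = tuples X k"
  proof
    show "J ` tuples X k \<subseteq> tuples X k"
      using guitar_closed by (auto simp: tuples_iff)
    show "tuples X k \<subseteq> J ` tuples X k"
    proof
      fix ys assume ys: "ys \<in> tuples X k"
      then obtain xs where "set xs \<subseteq> X" "J xs = ys"
        using guitar_surj by (auto simp: tuples_iff)
      with ys show "ys \<in> J ` tuples X k"
        by (metis image_eqI length_guitar tuples_iff)
    qed
  qed
qed

lemma guitar_inv_guitar: "xs \<in> tuples X k \<Longrightarrow> guitar_inv X \<sigma> k (J xs) = xs"
  using bij_guitar unfolding guitar_inv_def bij_betw_def by (simp add: inv_into_f_f)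

section \<open>Effect of pulls on guitar components\<close>

lemma nth_guitar: "J (us @ x # vs) ! length us = foldl R x vs"
  by (induction us) (auto simp: guitar_Cons)

lemma drop_Suc_guitar: "drop (Suc (length us)) (J (us @ x # vs)) = J vs"
  by (induction us) (auto simp: guitar_Cons)

text \<open>Each entry is an instance of \<open>sdot_foldl\<close>. The acting element is the same
  throughout because \<open>foldl R x vs\<close> does not change when \<open>x\<close> advances by
  one crossing.\<close>

lemma guitar_pull_right:
  assumes "x \<in> X" "set vs \<subseteq> X"
  shows "J (P x vs) = map (sdot X \<sigma> (foldl R x vs)) (J vs)"
  using assms
  by (induction vs arbitrary: x) (auto simp: guitar_Nil guitar_Cons sdot_foldl)

text \<open>For an entry of \<open>us\<close>, apply \<open>tdot_foldl\<close> with \<open>w\<close>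
  the value that this entry has on reaching \<open>x\<close>.\<close>

lemma guitar_pull_right_append:
  assumes "x \<in> X" "set us \<subseteq> X" "set vs \<subseteq> X"
  shows "J (us @ P x vs) =
    map (tdot X \<sigma> (foldl R x vs)) (take (length us) (J (us @ x # vs))) @
    map (sdot X \<sigma> (foldl R x vs)) (J vs)"
  using assms
  by (induction us) (auto simp: guitar_pull_right guitar_Cons tdot_foldl)

text \<open>By part (3) of \<open>pull_cross\<close>, the entries that \<open>x\<close> passes on
  its way left keep their guitar components. This is why \<open>face'\<close> merely deletes one
  component.\<close>

lemma guitar_pull_left_append:
  assumes "x \<in> X" "set us \<subseteq> X" "set vs \<subseteq> X"
  shows "J (Q us x @ vs) = take (length us) (J (us @ x # vs)) @ J vs"
  using assms
  by (induction us) (auto simp: guitar_Cons pull_cross)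

text \<open>Each shelf operation moves \<open>x\<close> past one more entry of \<open>us\<close>, so
  the iteration ends with the first guitar component of the word in which \<open>x\<close> has been
  pulled to the front.\<close>

lemma foldl_shelf_guitar:
  assumes "x \<in> X" "set us \<subseteq> X" "set vs \<subseteq> X"
  shows "foldl (shelf X \<sigma>) (foldl R x vs) (rev (take (length us) (J (us @ x # vs)))) =
    foldl R (foldr L us x) (Q us x @ vs)"
  using assms
proof (induction us)
  case (Cons u us)
  let ?z = "foldr L us x" and ?w = "Q us x @ vs"
  have w: "set ?w \<subseteq> X" using Cons.prems pull_left_closed by simp
  \<comment> \<open>The component of \<open>u\<close> is computed after the pull of \<open>x\<close>
    through \<open>us\<close>; this is the shape in which \<open>shelf_foldl\<close> crosses
    \<open>u\<close> with \<open>?z\<close>.\<close>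
  have "foldl R u (us @ x # vs) = foldl R (R u ?z) ?w"
    using Cons.prems by (simp add: pull_cross)
  with shelf_foldl[of u ?z ?w] w Cons show ?case
    by (simp add: guitar_Cons)
qed (simp add: guitar_Cons)

text \<open>The list to which \<open>chi\<close> applies \<open>guitar_inv\<close> is the guitar
  image of the word with \<open>x\<close> pulled to the front, so its inverse image starts with the
  pulled \<open>x\<close>.\<close>

lemma chi_guitar:
  assumes "x \<in> X" "set us \<subseteq> X" "set vs \<subseteq> X"
    and "i = Suc (length us)" "k = Suc (length us + length vs)"
  shows "chi X \<sigma> k i (J (us @ x # vs)) = foldr L us x"
proof -
  let ?xs = "foldr L us x # Q us x @ vs"
  have "foldl (shelf X \<sigma>) (J (us @ x # vs) ! (i - 1)) (rev (take (i - 1) (J (us @ x # vs)))) #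
      take (i - 1) (J (us @ x # vs)) @ drop i (J (us @ x # vs)) = J ?xs"
    using assms
    by (simp add: nth_guitar drop_Suc_guitar foldl_shelf_guitar guitar_Cons
        guitar_pull_left_append)
  moreover have "?xs \<in> tuples X k"
    using assms pull_left_closed by (simp add: tuples_iff)
  ultimately show ?thesis
    by (simp add: chi_def guitar_inv_guitar)
qed

end

section \<open>Face maps with module coefficients\<close>

locale module_pair = left_nondegenerate_braided_set X \<sigma>
  for X :: "'x set" and \<sigma> :: "'x \<times> 'x \<Rightarrow> 'x \<times> 'x" +
  fixes M :: "'m set" and \<rho> :: "'m \<Rightarrow> 'x \<Rightarrow> 'm"
    and N :: "'n set" and \<mu> :: "'x \<Rightarrow> 'n \<Rightarrow> 'n"
  assumes right_mod: "right_module X \<sigma> M \<rho>"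
    and left_mod: "left_module X \<sigma> N \<mu>"
begin

lemma right_action_closed [simp]: "m \<in> M \<Longrightarrow> a \<in> X \<Longrightarrow> \<rho> m a \<in> M"
  using right_mod unfolding right_module_def by auto

lemma left_action_closed [simp]: "a \<in> X \<Longrightarrow> n \<in> N \<Longrightarrow> \<mu> a n \<in> N"
  using left_mod unfolding left_module_def by auto

lemma right_action:
  "m \<in> M \<Longrightarrow> a \<in> X \<Longrightarrow> b \<in> X \<Longrightarrow> \<rho> (\<rho> m (L a b)) (R a b) = \<rho> (\<rho> m a) b"
  using right_mod unfolding right_module_def by metis

lemma left_action:
  "a \<in> X \<Longrightarrow> b \<in> X \<Longrightarrow> n \<in> N \<Longrightarrow> \<mu> (L a b) (\<mu> (R a b) n) = \<mu> a (\<mu> b n)"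
  using left_mod unfolding left_module_def by metis

text \<open>For equal signs both strands are pulled in the same direction, and the module axiom
  absorbs their crossing. For opposite signs they either move apart, touching disjoint parts of the
  tuple, or move through each other, which is \<open>pull_cross\<close>.\<close>

lemma pre_cubical_braided: "pre_cubical (chain_set M X N) (d_left_plus \<sigma> \<rho>) (d_right_minus \<sigma> \<mu>)"
  (is "pre_cubical ?C ?l ?r")
proof -
  have closed: "?l k i c \<in> ?C (k - 1) \<and> ?r k i c \<in> ?C (k - 1)"
    if ik: "1 \<le> i" "i \<le> k" and c: "c \<in> ?C k" for k i c
  proof -
    obtain m xs n where c': "c = (m, xs, n)" by (metis prod_cases3)
    then have len: "length xs = k" using c by (simp add: chain_set_def tuples_iff)
    obtain us x vs where xs: "xs = us @ x # vs" "i = Suc (length us)"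
      by (rule split_at[of i xs]) (use ik len in simp_all)
    have k: "k = Suc (length us + length vs)" using xs len by simp
    show ?thesis
      using c xs(2) k unfolding c' xs(1)
      by (simp add: d_left_plus_append d_right_minus_append chain_set_def tuples_iff
          pull_left_closed pull_right_closed)
  qed
  have cub: "?l (k - 1) i (?l k j c) = ?l (k - 1) (j - 1) (?l k i c) \<and>
      ?r (k - 1) i (?r k j c) = ?r (k - 1) (j - 1) (?r k i c) \<and>
      ?l (k - 1) i (?r k j c) = ?r (k - 1) (j - 1) (?l k i c) \<and>
      ?r (k - 1) i (?l k j c) = ?l (k - 1) (j - 1) (?r k i c)"
    if ij: "1 \<le> i" "i < j" "j \<le> k" and c: "c \<in> ?C k" for k i j c
  proof -
    obtain m xs n where c': "c = (m, xs, n)" by (metis prod_cases3)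
    then have len: "length xs = k" using c by (simp add: chain_set_def tuples_iff)
    obtain us' y ws where xs: "xs = us' @ y # ws" "j = Suc (length us')"
      by (rule split_at[of j xs]) (use ij len in simp_all)
    obtain us x vs where us': "us' = us @ x # vs" "i = Suc (length us)"
      by (rule split_at[of i us']) (use ij xs(2) in simp_all)
    have idx: "i = Suc (length us)" "j = Suc (Suc (length us + length vs))"
      "k = Suc (Suc (length us + length vs + length ws))"
      using xs us' len by simp_all
    have mem: "x \<in> X" "y \<in> X" "set us \<subseteq> X" "set vs \<subseteq> X" "set ws \<subseteq> X" "m \<in> M" "n \<in> N"
      using c unfolding c' xs us' by (auto simp: chain_set_def tuples_iff)
    \<comment> \<open>The same tuple is bracketed at \<open>x\<close> for the faces with index
      \<open>i\<close> and at \<open>y\<close> for those with index \<open>j\<close>.\<close>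
    have c1: "c = (m, us @ x # (vs @ y # ws), n)" and c2: "c = (m, (us @ x # vs) @ y # ws, n)"
      using c' xs us' by simp_all
    let ?z = "foldr L vs y" and ?f = "foldl R x vs"
    have zf: "?z \<in> X" "?f \<in> X" using mem by simp_all
    have li: "?l k i c = (\<rho> m (foldr L us x), (Q us x @ vs) @ y # ws, n)"
      unfolding c1 by (subst d_left_plus_append) (simp_all add: idx)
    have lj: "?l k j c = (\<rho> m (foldr L us (L x ?z)), Q us (L x ?z) @ R x ?z # (Q vs y @ ws), n)"
      unfolding c2 by (subst d_left_plus_append) (simp_all add: idx pull_left_append)
    have ri: "?r k i c =
        (m, (us @ P x vs) @ L ?f y # P (R ?f y) ws, \<mu> (foldl R (R ?f y) ws) n)"
      unfolding c1 by (subst d_right_minus_append) (simp_all add: idx pull_right_append)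
    have rj: "?r k j c = (m, us @ x # (vs @ P y ws), \<mu> (foldl R y ws) n)"
      unfolding c2 by (subst d_right_minus_append) (simp_all add: idx)
    have "?l (k - 1) i (?l k j c) = ?l (k - 1) (j - 1) (?l k i c)"
    proof -
      have "?l (k - 1) i (?l k j c) =
          (\<rho> (\<rho> m (foldr L us (L x ?z))) (foldr L (Q us (L x ?z)) (R x ?z)),
            Q (Q us (L x ?z)) (R x ?z) @ Q vs y @ ws, n)"
        unfolding lj by (subst d_left_plus_append) (simp_all add: idx)
      \<comment> \<open>By \<open>pull_left_braid\<close>, the two elements acting on
        \<open>m\<close> here are turned by \<sigma> into those of the line before.\<close>
      also have "\<dots> = (\<rho> (\<rho> m (foldr L us x)) (foldr L (Q us x) ?z), Q (Q us x) ?z @ Q vs y @ ws, n)"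
        using right_action[of m "foldr L us x" "foldr L (Q us x) ?z"] mem zf
          pull_left_braid[OF mem(1) zf(1) mem(3)]
        by (simp add: pull_left_closed)
      also have "\<dots> = ?l (k - 1) (j - 1) (?l k i c)"
        unfolding li by (subst d_left_plus_append) (simp_all add: idx pull_left_append)
      finally show ?thesis .
    qed
    moreover have "?r (k - 1) i (?r k j c) = ?r (k - 1) (j - 1) (?r k i c)"
    proof -
      have "?r (k - 1) i (?r k j c) =
          (m, us @ P x vs @ P ?f (P y ws), \<mu> (foldl R ?f (P y ws)) (\<mu> (foldl R y ws) n))"
        unfolding rj by (subst d_right_minus_append) (simp_all add: idx pull_right_append)
      also have "\<dots> = (m, us @ P x vs @ P (L ?f y) (P (R ?f y) ws),
          \<mu> (foldl R (L ?f y) (P (R ?f y) ws)) (\<mu> (foldl R (R ?f y) ws) n))"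
        using left_action[of "foldl R ?f (P y ws)" "foldl R y ws" n] mem zf
          pull_right_braid[OF zf(2) mem(2,5)]
        by (simp add: pull_right_closed)
      also have "\<dots> = ?r (k - 1) (j - 1) (?r k i c)"
        unfolding ri by (subst d_right_minus_append) (simp_all add: idx)
      finally show ?thesis .
    qed
    \<comment> \<open>\<open>x\<close> leaves to the left and \<open>y\<close> to the right, so the
      two pulls do not interact.\<close>
    moreover have "?l (k - 1) i (?r k j c) = ?r (k - 1) (j - 1) (?l k i c)"
      unfolding rj li
      by (subst d_left_plus_append, simp add: idx, subst d_right_minus_append)
        (simp_all add: idx)
    \<comment> \<open>\<open>x\<close> leaves to the right and \<open>y\<close> to the left, so they
      cross inside the tuple.\<close>
    moreover have "?r (k - 1) i (?l k j c) = ?l (k - 1) (j - 1) (?r k i c)"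
      unfolding lj ri using mem
      by (subst d_left_plus_append, simp add: idx, subst d_right_minus_append)
        (simp_all add: idx pull_cross pull_left_append pull_right_append)
    ultimately show ?thesis by blast
  qed
  show ?thesis
    unfolding pre_cubical_def
  proof (intro conjI ballI allI impI)
    fix d and k i :: nat
    assume "d \<in> {?l, ?r}" "1 \<le> i \<and> i \<le> k"
    then show "d k i \<in> ?C k \<rightarrow> ?C (k - 1)"
      using closed[of i k] by blast
  next
    fix d e and k i j :: nat and c
    assume d: "d \<in> {?l, ?r}" "e \<in> {?l, ?r}"
      and ij: "1 \<le> i \<and> i < j \<and> j \<le> k" and c: "c \<in> ?C k"
    have "1 \<le> i" "i < j" "j \<le> k" using ij by simp_all
    from cub[OF this c] d
    show "d (k - 1) i (e k j c) = e (k - 1) (j - 1) (d k i c)"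
      by (elim insertE emptyE conjE; hypsubst)
  qed
qed

text \<open>After splitting at \<open>x\<close>, the element acting on \<open>N\<close> is
  \<open>foldl R x vs\<close>, which is exactly the guitar component of \<open>x\<close>, and the
  one acting on \<open>M\<close> is given by \<open>chi_guitar\<close>. The remaining components
  come from the two lemmas on guitar images of pulled words.\<close>

lemma ext_guitar_iso:
  "pre_cubical_iso
      (chain_set M X N) (d_left_plus \<sigma> \<rho>) (d_right_minus \<sigma> \<mu>)
      (chain_set M X N) (face' X \<sigma> \<rho>) (face X \<sigma> \<mu>)
      (ext_guitar \<sigma>)"
proof -
  have "bij_betw (ext_guitar \<sigma>) (chain_set M X N k) (chain_set M X N k)" for k
    unfolding ext_guitar_def chain_set_def
    by (intro bij_betw_map_prod bij_guitar) (simp_all add: bij_betw_def)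
  moreover have
    "ext_guitar \<sigma> (d_left_plus \<sigma> \<rho> k i c) = face' X \<sigma> \<rho> k i (ext_guitar \<sigma> c) \<and>
      ext_guitar \<sigma> (d_right_minus \<sigma> \<mu> k i c) = face X \<sigma> \<mu> k i (ext_guitar \<sigma> c)"
    if ik: "1 \<le> i" "i \<le> k" and c: "c \<in> chain_set M X N k" for k i c
  proof -
    obtain m xs n where c': "c = (m, xs, n)" by (metis prod_cases3)
    then have len: "length xs = k" using c by (simp add: chain_set_def tuples_iff)
    obtain us x vs where xs: "xs = us @ x # vs" "i = Suc (length us)"
      by (rule split_at[of i xs]) (use ik len in simp_all)
    have k: "k = Suc (length us + length vs)" using xs len by simp
    have mem: "x \<in> X" "set us \<subseteq> X" "set vs \<subseteq> X"
      using c unfolding c' xs by (auto simp: chain_set_def tuples_iff)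
    show ?thesis
      using mem xs(2) k unfolding c' xs(1)
      by (simp add: d_left_plus_append d_right_minus_append ext_guitar_def face_def face'_def
          chi_guitar guitar_pull_left_append guitar_pull_right_append nth_guitar drop_Suc_guitar)
  qed
  ultimately show ?thesis
    unfolding pre_cubical_iso_def by blast
qed

end

theorem theorem7p1:
  fixes X :: "'x set" and \<sigma> :: "'x \<times> 'x \<Rightarrow> 'x \<times> 'x"
    and M :: "'m set" and \<rho> :: "'m \<Rightarrow> 'x \<Rightarrow> 'm"
    and N :: "'n set" and \<mu> :: "'x \<Rightarrow> 'n \<Rightarrow> 'n"
  assumes "braided_set X \<sigma>"
    and "left_nondegenerate X \<sigma>"
    and "right_module X \<sigma> M \<rho>"
    and "left_module X \<sigma> N \<mu>"
  shows "pre_cubical (chain_set M X N) (face' X \<sigma> \<rho>) (face X \<sigma> \<mu>) \<and>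
    pre_cubical_iso
      (chain_set M X N) (d_left_plus \<sigma> \<rho>) (d_right_minus \<sigma> \<mu>)
      (chain_set M X N) (face' X \<sigma> \<rho>) (face X \<sigma> \<mu>)
      (ext_guitar \<sigma>)"
proof -
  interpret module_pair X \<sigma> M \<rho> N \<mu>
    using assms by unfold_locales
  show ?thesis
    using pre_cubical_transport[OF pre_cubical_braided ext_guitar_iso] ext_guitar_iso by blast
qed

end
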